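(* Let $n_R\ge 1$, let the resource poset be $R=\mathbb{R}_{\ge 0}^{n_R}$ with the componentwise order, let $\mathrm{dp}$ be a design problem from a functionality poset $F$ to $R$, fix $\bar x_F\in F$, and let $C=\mathcal R(\bar x_F)=\{x_R\in R\mid\langle\bar x_F,x_R\rangle\in\mathrm{dp}\}$ be the feasible resource set, assumed nonempty, closed, and convex. Then: (a) $0^+C=\mathbb{R}_{\ge 0}^{n_R}$, and $C$ is line-free and self-bounded. (b) For every $\varepsilon>0$ there exists a polyhedron $P\supseteq C$ with $0^+P=0^+C$ such that $P$ is an $(\varepsilon,0)$-approximation of $C$. (c) Any sequence $(P^\nu)$ of $(\varepsilon^\nu,0)$-approximations of $C$ with $\varepsilon^\nu\to 0$ converges to $C$ in the sense of Painlev\'e--Kuratowski.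
   Context: A design problem from $F$ to $R$ is an upper set of $F^{\mathrm{op}}\times R$ ($F^{\mathrm{op}}$ is $F$ with reversed order): a set of feasible pairs closed under decreasing $x_F$ and increasing $x_R$. In particular each feasible resource set $\mathcal R(\bar x_F)$ is an upper set of $R$. $\|\cdot\|$ is the Euclidean norm. For a nonempty closed convex set $C\subseteq\mathbb{R}^n$: the recession cone is $0^+C=\{d\mid x+td\in C\ \forall x\in C,\ \forall t\ge0\}$; $C$ is line-free if $0^+C\cap(-0^+C)=\{0\}$; if $0^+C\ne\{0\}$, $C$ is self-bounded if there is $y\in\mathbb{R}^n$ with $C\subseteq y+0^+C$. A polyhedron is a finite intersection of closed halfspaces; $\operatorname{vert}P$ is its set of vertices (extreme points). For nonempty $C_1,C_2\subseteq\mathbb{R}^n$, the excess is $e[C_1,C_2]=\sup_{c_1\in C_1}\inf_{c_2\in C_2}\|c_1-c_2\|$ and $d_{\mathrm H}(C_1,C_2)=\max\{e[C_1,C_2],e[C_2,C_1]\}$. For nonempty closed convex cones, $\bar d_{\mathrm H}(K_1,K_2)=d_{\mathrm H}(K_1\cap B_1(0),K_2\cap B_1(0))$ with $B_1(0)$ the closed unit ball. For $C$ nonempty, closed, convex and line-free, a line-free polyhedron $P$ is an $(\varepsilon,\delta)$-approximation of $C$ if (i) $e[\operatorname{vert}P,C]\le\varepsilon$, (ii) $\bar d_{\mathrm H}(0^+P,0^+C)\le\delta$, and (iii) $C\subseteq P$. Painlev\'e--Kuratowski convergence $P^\nu\to C$ means $\{x\mid\liminf_\nu\operatorname{dist}(x,P^\nu)=0\}=\{x\mid\lim_\nu\operatorname{dist}(x,P^\nu)=0\}=C$.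 *)

theory Defs
  imports "HOL-Analysis.Analysis"
begin

subsection \<open>Design problems\<close>

text \<open>Posets are carrier sets ordered by the order of the ambient type. The inequality on
  functionalities is reversed because a design problem is an upper set of the product of the
  opposite of \<open>F\<close> with \<open>R\<close>.\<close>

definition design_problem ::
    "'f::order set \<Rightarrow> 'r::order set \<Rightarrow> ('f \<times> 'r) set \<Rightarrow> bool" where
  "design_problem F R dp \<longleftrightarrow>
     dp \<subseteq> F \<times> R \<and>
     (\<forall>f\<in>F. \<forall>r\<in>R. \<forall>f'\<in>F. \<forall>r'\<in>R. (f, r) \<in> dp \<longrightarrow> f' \<le> f \<longrightarrow> r \<le> r' \<longrightarrow> (f', r') \<in> dp)"

definition feasible_resources :: "'r set \<Rightarrow> ('f \<times> 'r) set \<Rightarrow> 'f \<Rightarrow> 'r set" where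
  "feasible_resources R dp x = {r \<in> R. (x, r) \<in> dp}"

text \<open>The order on \<open>real ^ 'n\<close> is the componentwise one.\<close>

definition nonneg_orthant :: "(real ^ 'n) set" where
  "nonneg_orthant = {x. 0 \<le> x}"

subsection \<open>Recession cones\<close>

definition recession_cone :: "'a::real_vector set \<Rightarrow> 'a set" where
  "recession_cone C = {d. \<forall>x\<in>C. \<forall>t\<ge>0. x + t *\<^sub>R d \<in> C}"

definition line_free :: "'a::real_vector set \<Rightarrow> bool" where
  "line_free C \<longleftrightarrow> recession_cone C \<inter> uminus ` recession_cone C = {0}"

text \<open>Self-boundedness is a notion for sets with a nontrivial recession cone only; this
  requirement is part of the predicate.\<close>

definition self_bounded :: "'a::real_vector set \<Rightarrow> bool" where
  "self_bounded C \<longleftrightarrow>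
     recession_cone C \<noteq> {0} \<and> (\<exists>y. C \<subseteq> (\<lambda>d. y + d) ` recession_cone C)"

subsection \<open>Excess, Hausdorff distance and polyhedral approximation\<close>

text \<open>Distances between sets take values in the extended reals: the excess of an unbounded
  set may be infinite, and the distance to the empty set is \<open>\<infinity>\<close> (whereas the library's
  \<open>infdist\<close> would give \<open>0\<close>).\<close>

definition set_dist :: "'a::real_normed_vector \<Rightarrow> 'a set \<Rightarrow> ereal" where
  "set_dist x A = (INF a\<in>A. ereal (norm (x - a)))"

definition excess :: "'a::real_normed_vector set \<Rightarrow> 'a set \<Rightarrow> ereal" where
  "excess A B = (SUP a\<in>A. set_dist a B)"

definition hausdorff_dist :: "'a::real_normed_vector set \<Rightarrow> 'a set \<Rightarrow> ereal" where
  "hausdorff_dist A B = max (excess A B) (excess B A)"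

definition cone_hausdorff_dist :: "'a::real_normed_vector set \<Rightarrow> 'a set \<Rightarrow> ereal" where
  "cone_hausdorff_dist K L = hausdorff_dist (K \<inter> cball 0 1) (L \<inter> cball 0 1)"

definition vert :: "'a::real_vector set \<Rightarrow> 'a set" where
  "vert P = {x. x extreme_point_of P}"

definition approximation_of ::
    "real \<Rightarrow> real \<Rightarrow> 'a::euclidean_space set \<Rightarrow> 'a set \<Rightarrow> bool" where
  "approximation_of \<epsilon> \<delta> C P \<longleftrightarrow>
     polyhedron P \<and> line_free P \<and>
     excess (vert P) C \<le> ereal \<epsilon> \<and>
     cone_hausdorff_dist (recession_cone P) (recession_cone C) \<le> ereal \<delta> \<and>
     C \<subseteq> P"

subsection \<open>Painleve-Kuratowski convergence\<close>

definition pk_converges :: "(nat \<Rightarrow> 'a::real_normed_vector set) \<Rightarrow> 'a set \<Rightarrow> bool" where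
  "pk_converges P C \<longleftrightarrow>
     {x. liminf (\<lambda>\<nu>. set_dist x (P \<nu>)) = 0} = C \<and>
     {x. (\<lambda>\<nu>. set_dist x (P \<nu>)) \<longlonglongrightarrow> 0} = C"

end

theory Submission
  imports Defs
begin

text \<open>A feasible resource set \<open>C\<close> is a subset of the nonnegative orthant \<open>K\<close> that is closed upwards.
  Hence \<open>C\<close> recedes in every direction of \<open>K\<close>, and in no other, because a ray leaving \<open>K\<close> would
  leave \<open>C\<close> as well; this is \<open>recession_cone_upper_subset_orthant\<close>. The cone \<open>K\<close> contains no line, and
  \<open>C\<close> is contained in \<open>0 + K\<close>, so \<open>C\<close> is line-free and self-bounded.

  To approximate \<open>C\<close> from outside, round every point of \<open>C\<close> down to a grid of mesh
  \<open>h = \<epsilon> / n\<close>. This moves it by at most \<open>\<epsilon>\<close>. The rounded set is infinite in general, but by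
  Dickson's lemma (\<open>finitely_many_minimal_tuples\<close>) finitely many of its points, say \<open>S\<close>, lie below all
  others, and therefore below all of \<open>C\<close>. Then \<open>P = convex hull S + K\<close> contains \<open>C\<close> and is again an
  upper subset of \<open>K\<close>, so its recession cone is \<open>K\<close>; its vertices belong to \<open>S\<close> and hence are within
  \<open>\<epsilon>\<close> of \<open>C\<close>. It is a polyhedron because it is a slice of a finitely generated cone in one dimension
  more.

  For the convergence, let \<open>P\<close> be an \<open>(\<epsilon>, 0)\<close>-approximation of \<open>C\<close>. Distance zero between closed cones
  is equality, so \<open>P\<close> and \<open>C\<close> have the same recession cone. By Klee's theorem
  (\<open>line_free_eq_convex_hull_extreme_points_plus_recession_cone\<close>) each point of \<open>P\<close> is a
  convex combination of vertices of \<open>P\<close> plus a recession direction of \<open>C\<close>. The vertices lie in the convex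
  set \<open>C + cball 0 \<epsilon>\<close>, and this set is stable under the recession directions of \<open>C\<close>; so all of \<open>P\<close>,
  not only its vertices, is within \<open>\<epsilon>\<close> of \<open>C\<close>. Since moreover \<open>C\<close> is contained in \<open>P\<close>, letting
  \<open>\<epsilon>\<close> tend to \<open>0\<close> forces Painleve-Kuratowski convergence.\<close>

section \<open>Recession directions and extreme points\<close>

lemma line_freeI:
  fixes S :: "'a::real_vector set"
  assumes "\<And>d. d \<in> recession_cone S \<Longrightarrow> -d \<in> recession_cone S \<Longrightarrow> d = 0"
  shows "line_free S"
proof -
  have "0 \<in> recession_cone S"
    by (simp add: recession_cone_def)
  then show ?thesis
    unfolding line_free_def using assms by force
qed

lemma line_freeD: 
  fixes S :: "'a::real_vector set"
  shows "line_free S \<Longrightarrow> d \<in> recession_cone S \<Longrightarrow> -d \<in> recession_cone S \<Longrightarrow> d = 0"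
  unfolding line_free_def by (metis IntI imageI minus_minus singletonD)

lemma recession_coneD:
  "d \<in> recession_cone S \<Longrightarrow> x \<in> S \<Longrightarrow> t \<ge> 0 \<Longrightarrow> x + t *\<^sub>R d \<in> S"
  by (simp add: recession_cone_def)

lemma recession_cone_add:
  fixes S :: "'a::real_vector set"
  assumes "d \<in> recession_cone S" "e \<in> recession_cone S"
  shows "d + e \<in> recession_cone S"
  using assms by (simp add: recession_cone_def scaleR_add_right flip: add.assoc)

lemma recession_cone_scaleR:
  fixes S :: "'a::real_vector set"
  assumes "d \<in> recession_cone S" "0 \<le> c"
  shows "c *\<^sub>R d \<in> recession_cone S"
  using assms by (simp add: recession_cone_def)

lemma convex_recession_cone:
  fixes S :: "'a::real_vector set"
  shows "convex (recession_cone S)"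
  by (intro convexI recession_cone_add recession_cone_scaleR)

lemma closed_recession_cone:
  fixes S :: "'a::real_normed_vector set"
  assumes "closed S"
  shows "closed (recession_cone S)"
proof -
  have "recession_cone S = (\<Inter>x\<in>S. \<Inter>t\<in>{0..}. (\<lambda>d. x + t *\<^sub>R d) -` S)"
    by (auto simp: recession_cone_def)
  moreover have "closed ((\<lambda>d. x + t *\<^sub>R d) -` S)" for x t
    by (intro continuous_closed_vimage assms) (intro continuous_intros)
  ultimately show ?thesis
    by (simp add: closed_INT)
qed

text \<open>In a closed convex set one ray suffices: from any other point \<open>y\<close>, the point \<open>y + t *\<^sub>R d\<close> is the
  limit of points on the segments that join \<open>y\<close> to ever more remote points of the given ray.\<close>

lemma ray_in_recession_cone:
  fixes S :: "'a::real_normed_vector set"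
  assumes "convex S" "closed S" "x \<in> S" and ray: "\<And>t. t \<ge> 0 \<Longrightarrow> x + t *\<^sub>R d \<in> S"
  shows "d \<in> recession_cone S"
proof -
  have "y + t *\<^sub>R d \<in> S" if "y \<in> S" "t \<ge> 0" for y t
  proof (rule closed_sequentially[OF \<open>closed S\<close>])
    let ?r = "\<lambda>n. inverse (real (Suc n))"
    show "y + t *\<^sub>R d + ?r n *\<^sub>R (x - y) \<in> S" for n
    proof -
      have "x + (real (Suc n) * t) *\<^sub>R d \<in> S"
        using that by (intro ray) simp
      then have "(1 - ?r n) *\<^sub>R y + ?r n *\<^sub>R (x + (real (Suc n) * t) *\<^sub>R d) \<in> S"
        using assms that by (intro convexD_alt) (auto simp: inverse_le_1_iff)
      moreover have "?r n *\<^sub>R ((real (Suc n) * t) *\<^sub>R d) = t *\<^sub>R d"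
        by (simp del: of_nat_Suc)
      ultimately show ?thesis
        by (simp add: algebra_simps del: of_nat_Suc)
    qed
    have "(\<lambda>n. y + t *\<^sub>R d + ?r n *\<^sub>R (x - y)) \<longlonglongrightarrow> y + t *\<^sub>R d + 0 *\<^sub>R (x - y)"
      by (intro tendsto_intros LIMSEQ_inverse_real_of_nat)
    then show "(\<lambda>n. y + t *\<^sub>R d + ?r n *\<^sub>R (x - y)) \<longlonglongrightarrow> y + t *\<^sub>R d"
      by simp
  qed
  then show ?thesis
    by (simp add: recession_cone_def)
qed

text \<open>Otherwise the part of the segment inside \<open>S\<close> would be its part inside the relative interior, and so
  both closed and open in the connected segment.\<close>

lemma segment_leaves_through_rel_boundary:
  fixes S :: "'a::euclidean_space set"
  assumes "closed S" "x \<in> S" "z \<notin> S" "z \<in> affine hull S"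
  obtains y where "y \<in> closed_segment x z" "y \<in> S" "y \<notin> rel_interior S"
proof -
  let ?L = "closed_segment x z"
  have L: "?L \<subseteq> affine hull S"
    using assms by (intro closed_segment_subset) (auto simp: hull_inc affine_imp_convex)
  have False if eq: "?L \<inter> S \<subseteq> rel_interior S"
  proof -
    have *: "?L \<inter> rel_interior S = ?L \<inter> S"
      using eq rel_interior_subset[of S] by blast
    have "openin (top_of_set ?L) (?L \<inter> rel_interior S)"
    proof -
      obtain U where "open U" "rel_interior S = affine hull S \<inter> U"
        using openin_rel_interior[of S] unfolding openin_open by blast
      then have "?L \<inter> rel_interior S = ?L \<inter> U"
        using L by blast
      then show ?thesis
        using \<open>open U\<close> by (simp add: openin_open_Int)
    qed
    moreover have "closedin (top_of_set ?L) (?L \<inter> S)"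
      using assms by (simp add: closedin_closed_Int)
    ultimately have "?L \<inter> S = {} \<or> ?L \<inter> S = ?L"
      using connected_clopen[of ?L] * by simp
    then show False
      using assms by auto
  qed
  then show ?thesis
    using that by blast
qed

lemma rel_boundary_in_proper_face:
  fixes S :: "'a::euclidean_space set"
  assumes "convex S" "y \<in> S" "y \<notin> rel_interior S"
  obtains G where "G face_of S" "G \<noteq> S" "y \<in> G"
proof -
  obtain a where a: "\<And>z. z \<in> S \<Longrightarrow> a \<bullet> y \<le> a \<bullet> z"
      "\<And>z. z \<in> rel_interior S \<Longrightarrow> a \<bullet> y < a \<bullet> z"
    using supporting_hyperplane_rel_boundary[OF assms] by metis
  obtain c where "c \<in> rel_interior S"
    using assms rel_interior_eq_empty by blast
  then have "c \<in> S" "a \<bullet> y < a \<bullet> c"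
    using a rel_interior_subset by auto
  show ?thesis
  proof
    show "S \<inter> {z. a \<bullet> z = a \<bullet> y} face_of S"
      using a by (intro face_of_Int_supporting_hyperplane_ge assms) auto
    show "S \<inter> {z. a \<bullet> z = a \<bullet> y} \<noteq> S"
      using \<open>c \<in> S\<close> \<open>a \<bullet> y < a \<bullet> c\<close> by force
  qed (use assms in auto)
qed

text \<open>Klee's extension of the Minkowski and Krein-Milman theorems to unbounded sets, by induction on the
  dimension. A relative boundary point lies in a proper face, whose extreme points and recession
  directions are also those of \<open>S\<close>. For an arbitrary point take any line through it in the affine hull.
  As \<open>S\<close> contains no line, at least one of its two rays meets the relative boundary. Either the other ray does
  so too, and the point lies between two boundary points, or the other ray stays in \<open>S\<close>, and the point is a
  boundary point moved along a recession direction.\<close>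

theorem line_free_eq_convex_hull_extreme_points_plus_recession_cone:
  fixes S :: "'a::euclidean_space set"
  assumes "convex S" "closed S" "line_free S"
  shows "S = convex hull (vert S) + recession_cone S"
proof
  show "convex hull (vert S) + recession_cone S \<subseteq> S"
  proof -
    have "convex hull (vert S) \<subseteq> S"
      using assms by (intro hull_minimal) (auto simp: vert_def extreme_point_of_def)
    then show ?thesis
      using recession_coneD[of _ S _ 1] by (fastforce elim: set_plus_elim)
  qed
  show "S \<subseteq> convex hull (vert S) + recession_cone S"
    using assms
  proof (induction "nat (aff_dim S + 1)" arbitrary: S rule: less_induct)
    case (less S)
    let ?H = "convex hull (vert S) + recession_cone S"
    have conv: "convex ?H"
      by (intro convex_set_plus convex_convex_hull convex_recession_cone)
    have boundary: "y \<in> ?H" if y: "y \<in> S" "y \<notin> rel_interior S" for y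
    proof -
      obtain G where G: "G face_of S" "G \<noteq> S" "y \<in> G"
        using rel_boundary_in_proper_face[OF \<open>convex S\<close> y] .
      have cG: "convex G" "closed G" "G \<subseteq> S"
        using G less.prems by (auto intro: face_of_imp_convex face_of_imp_closed dest: face_of_imp_subset)
      have rec: "recession_cone G \<subseteq> recession_cone S"
      proof
        fix d assume d: "d \<in> recession_cone G"
        show "d \<in> recession_cone S"
          using cG G y less.prems recession_coneD[OF d \<open>y \<in> G\<close>]
          by (intro ray_in_recession_cone[where x=y]) auto
      qed
      have "y \<in> convex hull (vert G) + recession_cone G"
      proof -
        have "aff_dim G < aff_dim S"
          using G less.prems by (intro face_of_aff_dim_lt)
        then have "nat (aff_dim G + 1) < nat (aff_dim S + 1)"
          using aff_dim_geq[of G] by linarith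
        moreover have "line_free G"
          using rec less.prems by (intro line_freeI) (auto dest: line_freeD)
        ultimately show ?thesis
          using less.hyps cG \<open>y \<in> G\<close> by blast
      qed
      moreover have "vert G \<subseteq> vert S"
        using G by (auto simp: vert_def extreme_point_of_face)
      ultimately show ?thesis
        using rec by (meson hull_mono set_plus_mono2 subsetD)
    qed
    have exit: "\<exists>t\<ge>0. x + t *\<^sub>R u \<in> ?H"
      if x: "x \<in> S" and u: "x + u \<in> affine hull S" "u \<notin> recession_cone S" for x u
    proof -
      obtain T where T: "T \<ge> 0" "x + T *\<^sub>R u \<notin> S"
        using ray_in_recession_cone[OF less.prems(1,2) x] u by blast
      have "(1 - T) *\<^sub>R x + T *\<^sub>R (x + u) \<in> affine hull S"
        using x u by (intro mem_affine) (auto simp: hull_inc)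
      then have "x + T *\<^sub>R u \<in> affine hull S"
        by (simp add: algebra_simps)
      then obtain y where y: "y \<in> closed_segment x (x + T *\<^sub>R u)" "y \<in> S" "y \<notin> rel_interior S"
        using segment_leaves_through_rel_boundary less.prems x T by metis
      then obtain s where "0 \<le> s" "y = (1 - s) *\<^sub>R x + s *\<^sub>R (x + T *\<^sub>R u)"
        by (auto simp: in_segment)
      then have "y = x + (s * T) *\<^sub>R u" "0 \<le> s * T"
        using T by (auto simp: algebra_simps)
      then show ?thesis
        using boundary[OF y(2,3)] by metis
    qed
    show ?case
    proof
      fix x assume x: "x \<in> S"
      show "x \<in> ?H"
      proof (cases "S = {x}")
        case True
        then have "x \<in> vert S"
          by (auto simp: vert_def extreme_point_of_def)
        moreover have "0 \<in> recession_cone S"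
          by (simp add: recession_cone_def)
        ultimately have "x + 0 \<in> ?H"
          by (intro set_plus_intro hull_inc)
        then show ?thesis
          by simp
      next
        case False
        then obtain z where z: "z \<in> S" "z \<noteq> x"
          using x by blast
        \<comment> \<open>One of \<open>z - x\<close> and its negative is not a recession direction. The line through \<open>x\<close> and
          \<open>z\<close> is oriented so that its backward ray leaves \<open>S\<close>.\<close>
        obtain u where u: "x + u \<in> affine hull S" "x - u \<in> affine hull S" "- u \<notin> recession_cone S"
        proof -
          have *: "z \<in> affine hull S" "2 *\<^sub>R x - z \<in> affine hull S"
          proof -
            show "z \<in> affine hull S" using z by (simp add: hull_inc)
            have "2 *\<^sub>R x + (-1) *\<^sub>R z \<in> affine hull S"
              using x z by (intro mem_affine) (auto simp: hull_inc)
            then show "2 *\<^sub>R x - z \<in> affine hull S" by simp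
          qed
          show ?thesis
          proof (cases "- (z - x) \<in> recession_cone S")
            case False
            show ?thesis
              by (rule that[of "z - x"]) (use * False in \<open>auto simp: scaleR_2 algebra_simps\<close>)
          next
            case True
            then have "z - x \<notin> recession_cone S"
              using line_freeD[OF \<open>line_free S\<close>, of "z - x"] z by auto
            then show ?thesis
              by (intro that[of "x - z"]) (use * in \<open>auto simp: scaleR_2 algebra_simps\<close>)
          qed
        qed
        then obtain s where s: "s \<ge> 0" "x + s *\<^sub>R (- u) \<in> ?H"
          using exit[OF x, of "-u"] by auto
        show ?thesis
        proof (cases "u \<in> recession_cone S")
          case True
          then have "s *\<^sub>R u \<in> recession_cone S"
            using s by (intro recession_cone_scaleR)
          moreover obtain p d where pd: "p \<in> convex hull (vert S)" "d \<in> recession_cone S"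
              "x + s *\<^sub>R (- u) = p + d"
            using s by (auto elim: set_plus_elim)
          ultimately have "p + (d + s *\<^sub>R u) \<in> ?H"
            by (intro set_plus_intro recession_cone_add)
          moreover have "p + (d + s *\<^sub>R u) = x"
            using pd(3) by (simp add: algebra_simps)
          ultimately show ?thesis
            by simp
        next
          case False
          then obtain t where t: "t \<ge> 0" "x + t *\<^sub>R u \<in> ?H"
            using exit[OF x u(1)] by auto
          show ?thesis
          proof (cases "s + t = 0")
            case True
            then have "t = 0" using s(1) t(1) by simp
            then show ?thesis using t(2) by simp
          next
            case False
            let ?c = "s / (s + t)" and ?d = "t / (s + t)"
            have pos: "s + t > 0" using False s(1) t(1) by simp
            have cd: "?c + ?d = 1" using pos by (simp flip: add_divide_distrib)
            have "?c *\<^sub>R (x + t *\<^sub>R u) + ?d *\<^sub>R (x + s *\<^sub>R (- u)) \<in> ?H"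
              using cd s t pos by (intro convexD[OF conv]) auto
            also have "?c *\<^sub>R (x + t *\<^sub>R u) + ?d *\<^sub>R (x + s *\<^sub>R (- u)) = (?c + ?d) *\<^sub>R x"
              by (simp add: algebra_simps)
            finally show ?thesis
              by (simp only: cd scaleR_one)
          qed
        qed
      qed
    qed
  qed
qed

section \<open>Polyhedra generated by finitely many points and directions\<close>

lemma polyhedron_slice:
  fixes W :: "('a::euclidean_space \<times> real) set"
  assumes "polyhedron W"
  shows "polyhedron {x. (x, s) \<in> W}"
proof -
  obtain \<F> where \<F>: "finite \<F>" "W = \<Inter>\<F>" "\<And>h. h \<in> \<F> \<Longrightarrow> \<exists>a b. h = {w. a \<bullet> w \<le> b}"
    using assms unfolding polyhedron_def by metis
  have "polyhedron {x. (x, s) \<in> h}" if h: "h \<in> \<F>" for h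
  proof -
    obtain a b where "h = {w. a \<bullet> w \<le> b}"
      using \<F>(3)[OF h] by blast
    then have "{x. (x, s) \<in> h} = {x. fst a \<bullet> x \<le> b - snd a * s}"
      by (auto simp: inner_prod_def)
    then show ?thesis
      by (simp add: polyhedron_halfspace_le)
  qed
  then have "polyhedron (\<Inter>h\<in>\<F>. {x. (x, s) \<in> h})"
    using \<F>(1) by (intro polyhedron_Inter) auto
  also have "(\<Inter>h\<in>\<F>. {x. (x, s) \<in> h}) = {x. (x, s) \<in> W}"
    using \<F>(2) by auto
  finally show ?thesis .
qed

text \<open>Homogenization: at height \<open>1\<close>, the cone generated by the points of \<open>S\<close> placed at height \<open>1\<close> and
  the directions of \<open>B\<close> placed at height \<open>0\<close> has as its slice the sum of the convex hull and the
  cone.\<close>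

lemma polyhedron_convex_hull_plus_convex_cone_hull:
  fixes S B :: "'a::euclidean_space set"
  assumes "finite S" "finite B"
  shows "polyhedron (convex hull S + convex_cone hull B)"
proof (cases "S = {}")
  case True
  then show ?thesis
    by (simp add: set_plus_def)
next
  case False
  let ?W = "convex_cone hull (S \<times> {1} \<union> B \<times> {0}) :: ('a \<times> real) set"
  have S: "convex_cone hull (S \<times> {1::real}) = {(c *\<^sub>R p, c) |c p. 0 \<le> c \<and> p \<in> convex hull S}"
    using False by (auto simp: convex_cone_hull_convex_hull_nonempty convex_hull_Times)
  have B: "convex_cone hull (B \<times> {0::real}) = (convex_cone hull B) \<times> {0}"
  proof -
    have "linear (\<lambda>x::'a. (x, 0::real))"
      by (intro linearI) auto
    from convex_cone_hull_linear_image[OF this, of B] show ?thesis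
      by (simp add: image_Pair_const flip: insert_Times_insert)
  qed
  have "convex hull S + convex_cone hull B = {x. (x, 1) \<in> ?W}"
    unfolding convex_cone_hull_Un S B by (force simp: set_plus_def)
  moreover have "polyhedron ?W"
    using assms by (intro polyhedron_convex_cone_hull) auto
  ultimately show ?thesis
    by (simp add: polyhedron_slice)
qed

text \<open>A point \<open>p + k\<close> with \<open>k \<noteq> 0\<close> is the midpoint of \<open>p\<close> and \<open>p + 2 *\<^sub>R k\<close>, hence not extreme.\<close>

lemma vert_plus_subset:
  fixes A K :: "'a::real_vector set"
  assumes "\<And>k. k \<in> K \<Longrightarrow> 2 *\<^sub>R k \<in> K" "0 \<in> K"
  shows "vert (A + K) \<subseteq> vert A"
proof
  fix x assume "x \<in> vert (A + K)"
  then have x: "x \<in> A + K" "\<And>a b. a \<in> A + K \<Longrightarrow> b \<in> A + K \<Longrightarrow> x \<notin> open_segment a b"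
    by (auto simp: vert_def extreme_point_of_def)
  then obtain p k where pk: "p \<in> A" "k \<in> K" "x = p + k"
    by (auto elim: set_plus_elim)
  have sub: "A \<subseteq> A + K"
    using set_plus_intro[OF _ assms(2)] by fastforce
  have "k = 0"
  proof (rule ccontr)
    assume "k \<noteq> 0"
    moreover have "midpoint p (p + 2 *\<^sub>R k) = x"
      by (simp add: pk midpoint_def scaleR_2 algebra_simps flip: scaleR_add_left)
    ultimately have "x \<in> open_segment p (p + 2 *\<^sub>R k)"
      using midpoint_in_open_segment[of p "p + 2 *\<^sub>R k"] by simp
    moreover have "p \<in> A + K" "p + 2 *\<^sub>R k \<in> A + K"
      using pk assms sub by (auto intro: set_plus_intro)
    ultimately show False
      using x by blast
  qed
  then show "x \<in> vert A"
    using pk x sub by (auto simp: vert_def extreme_point_of_def)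
qed

section \<open>The nonnegative orthant and its upper subsets\<close>

lemma nonneg_orthant_iff: "x \<in> nonneg_orthant \<longleftrightarrow> (\<forall>i. 0 \<le> x $ i)"
  by (simp add: nonneg_orthant_def less_eq_vec_def)

lemma nonneg_orthant_eq_convex_cone_hull:
  "nonneg_orthant = convex_cone hull (range (\<lambda>i. axis i 1) :: (real ^ 'n) set)"
proof
  show "convex_cone hull (range (\<lambda>i. axis i 1)) \<subseteq> (nonneg_orthant :: (real ^ 'n) set)"
    by (rule hull_minimal) (auto simp: convex_cone_iff nonneg_orthant_iff axis_def)
  show "nonneg_orthant \<subseteq> convex_cone hull (range (\<lambda>i. axis i 1) :: (real ^ 'n) set)"
  proof
    fix x :: "real ^ 'n" assume x: "x \<in> nonneg_orthant"
    have "(\<Sum>i\<in>I. (x $ i) *\<^sub>R axis i 1) \<in> convex_cone hull (range (\<lambda>i. axis i 1) :: (real ^ 'n) set)"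
      if "finite I" for I
      using that
    proof (induction I)
      case (insert i I)
      then show ?case
        using x by (simp add: convex_cone_hull_add convex_cone_hull_mul hull_inc nonneg_orthant_iff)
    qed (simp add: convex_cone_hull_contains_0)
    from this[OF finite_class.finite_UNIV] show "x \<in> convex_cone hull (range (\<lambda>i. axis i 1))"
      using basis_expansion[of x] by (simp add: scalar_mult_eq_scaleR)
  qed
qed

lemma recession_cone_upper_subset_orthant:
  fixes C :: "(real ^ 'n) set"
  assumes "C \<noteq> {}" and sub: "C \<subseteq> nonneg_orthant"
    and up: "\<And>x y. x \<in> C \<Longrightarrow> x \<le> y \<Longrightarrow> y \<in> C"
  shows "recession_cone C = nonneg_orthant"
proof (intro equalityI subsetI)
  fix d :: "real ^ 'n" assume d: "d \<in> nonneg_orthant"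
  show "d \<in> recession_cone C"
    unfolding recession_cone_def
  proof (intro CollectI ballI allI impI)
    fix x and t :: real assume "x \<in> C" "0 \<le> t"
    moreover have "x \<le> x + t *\<^sub>R d"
      using d \<open>0 \<le> t\<close> by (simp add: less_eq_vec_def nonneg_orthant_iff)
    ultimately show "x + t *\<^sub>R d \<in> C"
      using up by blast
  qed
next
  fix d assume d: "d \<in> recession_cone C"
  obtain x where x: "x \<in> C"
    using assms by blast
  have "0 \<le> d $ i" for i
  proof (rule ccontr)
    assume neg: "\<not> 0 \<le> d $ i"
    \<comment> \<open>At time \<open>t\<close> the ray from \<open>x\<close> has \<open>i\<close>-th coordinate \<open>-1\<close>.\<close>
    define t where "t = (x $ i + 1) / - (d $ i)"
    have "0 \<le> x $ i"
      using x sub by (auto simp: nonneg_orthant_iff)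
    then have "t \<ge> 0"
      using neg by (simp add: t_def divide_nonneg_neg)
    then have "x + t *\<^sub>R d \<in> nonneg_orthant"
      using d x sub recession_coneD by blast
    then have "0 \<le> x $ i + t * d $ i"
      by (simp add: nonneg_orthant_iff)
    also have "\<dots> = -1"
      using neg by (simp add: t_def field_simps)
    finally show False by simp
  qed
  then show "d \<in> nonneg_orthant"
    by (simp add: nonneg_orthant_iff)
qed

lemma line_free_if_recession_cone_orthant:
  fixes C :: "(real ^ 'n) set"
  assumes "recession_cone C = nonneg_orthant"
  shows "line_free C"
proof (rule line_freeI)
  fix d assume "d \<in> recession_cone C" "- d \<in> recession_cone C"
  then have "d $ i = 0" for i
    unfolding assms nonneg_orthant_iff by (metis antisym neg_0_le_iff_le vector_uminus_component)
  then show "d = 0"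
    by (simp add: vec_eq_iff)
qed

text \<open>Dickson's lemma, by induction on the set of coordinates compared. Let \<open>S\<close> work for \<open>I\<close> and
  let \<open>M\<close> bound the \<open>j\<close>-th coordinates of its elements. Then \<open>S\<close> also works for \<open>insert j I\<close> as
  far as tuples with \<open>j\<close>-th coordinate at least \<open>M\<close> are concerned. The others fall into finitely many
  layers with constant \<open>j\<close>-th coordinate, on each of which only \<open>I\<close> matters.\<close>

lemma finitely_many_minimal_tuples:
  fixes G :: "('i \<Rightarrow> nat) set"
  assumes "finite I"
  shows "\<exists>S\<subseteq>G. finite S \<and> (\<forall>g\<in>G. \<exists>s\<in>S. \<forall>i\<in>I. s i \<le> g i)"
  using assms
proof (induction I arbitrary: G)
  case empty
  show ?case
  proof (cases "G = {}")
    case False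
    then obtain g where "g \<in> G" by blast
    then show ?thesis by (intro exI[of _ "{g}"]) auto
  qed auto
next
  case (insert j I)
  obtain S where S: "S \<subseteq> G" "finite S" "\<And>g. g \<in> G \<Longrightarrow> \<exists>s\<in>S. \<forall>i\<in>I. s i \<le> g i"
    using insert.IH[of G] by metis
  define M where "M = Max (insert 0 ((\<lambda>s. s j) ` S))"
  have M: "s j \<le> M" if "s \<in> S" for s
    using that S(2) by (auto simp: M_def)
  have "\<forall>m. \<exists>T\<subseteq>{g \<in> G. g j = m}. finite T \<and> (\<forall>g\<in>{g \<in> G. g j = m}. \<exists>s\<in>T. \<forall>i\<in>I. s i \<le> g i)"
    by (intro allI insert.IH)
  from choice[OF this] obtain T where "\<forall>m. T m \<subseteq> {g \<in> G. g j = m} \<and> finite (T m) \<and>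
      (\<forall>g\<in>{g \<in> G. g j = m}. \<exists>s\<in>T m. \<forall>i\<in>I. s i \<le> g i)"
    by blast
  then have T: "\<And>m. T m \<subseteq> {g \<in> G. g j = m}" "\<And>m. finite (T m)"
      "\<And>m g. g \<in> G \<Longrightarrow> g j = m \<Longrightarrow> \<exists>s\<in>T m. \<forall>i\<in>I. s i \<le> g i"
    by blast+
  show ?case
  proof (intro exI[of _ "S \<union> (\<Union>m<M. T m)"] conjI ballI)
    fix g assume g: "g \<in> G"
    show "\<exists>s\<in>S \<union> (\<Union>m<M. T m). \<forall>i\<in>insert j I. s i \<le> g i"
    proof (cases "g j < M")
      case True
      obtain s where s: "s \<in> T (g j)" "\<forall>i\<in>I. s i \<le> g i"
        using T(3)[OF g refl] by blast
      moreover have "s j = g j"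
        using s T(1) by blast
      ultimately show ?thesis
        using True by (intro bexI[of _ s]) auto
    next
      case False
      obtain s where "s \<in> S" "\<forall>i\<in>I. s i \<le> g i"
        using S(3)[OF g] by blast
      then show ?thesis
        using False M[of s] by (intro bexI[of _ s]) auto
    qed
  next
    show "S \<union> (\<Union>m<M. T m) \<subseteq> G"
      using S(1) T(1) by blast
    show "finite (S \<union> (\<Union>m<M. T m))"
      using S(2) T(2) by simp
  qed
qed

text \<open>The points of \<open>S\<close> are points of \<open>C\<close> rounded down to a grid. Rounding keeps them close to \<open>C\<close>,
  and Dickson's lemma selects finitely many that suffice to have one below each point of \<open>C\<close>.\<close>

lemma finite_lower_net:
  fixes C :: "(real ^ 'n) set"
  assumes "C \<subseteq> nonneg_orthant" "\<epsilon> > 0"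
  obtains S where "finite S" "S \<subseteq> nonneg_orthant"
    "\<And>s. s \<in> S \<Longrightarrow> \<exists>c\<in>C. norm (s - c) \<le> \<epsilon>" "\<And>c. c \<in> C \<Longrightarrow> \<exists>s\<in>S. s \<le> c"
proof -
  \<comment> \<open>Rounding errors of at most \<open>h\<close> in each coordinate add up to at most \<open>\<epsilon>\<close> in the l1-norm,
    which dominates the Euclidean one.\<close>
  define h where "h = \<epsilon> / CARD('n)"
  have h: "h > 0"
    using assms by (simp add: h_def)
  define g :: "real ^ 'n \<Rightarrow> 'n \<Rightarrow> nat" where "g x i = nat \<lfloor>x $ i / h\<rfloor>" for x i
  define r :: "('n \<Rightarrow> nat) \<Rightarrow> real ^ 'n" where "r f = (\<chi> i. h * real (f i))" for f
  have g: "h * real (g x i) \<le> x $ i \<and> x $ i \<le> h * real (g x i) + h" if "x \<in> C" for x i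
  proof -
    have "0 \<le> x $ i"
      using that assms by (auto simp: nonneg_orthant_iff)
    then have "real (g x i) = of_int \<lfloor>x $ i / h\<rfloor>"
      using h by (simp add: g_def)
    moreover have "x $ i / h = of_int \<lfloor>x $ i / h\<rfloor> + frac (x $ i / h)"
      by (simp add: frac_def)
    ultimately have "x $ i = h * real (g x i) + h * frac (x $ i / h)"
      using h by (metis distrib_left less_irrefl nonzero_mult_div_cancel_left times_divide_eq_right)
    moreover have "0 \<le> h * frac (x $ i / h)" "h * frac (x $ i / h) \<le> h"
      using h frac_lt_1[of "x $ i / h"] by (auto simp: mult_le_cancel_left1 less_imp_le)
    ultimately show ?thesis
      by linarith
  qed
  obtain T where T: "T \<subseteq> g ` C" "finite T" "\<And>f. f \<in> g ` C \<Longrightarrow> \<exists>t\<in>T. \<forall>i. t i \<le> f i"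
    using finitely_many_minimal_tuples[of "UNIV :: 'n set" "g ` C"] by auto
  show ?thesis
  proof
    show "finite (r ` T)"
      using T by simp
    show "r ` T \<subseteq> nonneg_orthant"
      using h by (auto simp: r_def nonneg_orthant_iff)
    show "\<exists>c\<in>C. norm (s - c) \<le> \<epsilon>" if s: "s \<in> r ` T" for s
    proof -
      obtain c where c: "c \<in> C" "s = r (g c)"
        using s T(1) by blast
      have "norm (s - c) \<le> (\<Sum>i\<in>UNIV. \<bar>(s - c) $ i\<bar>)"
        by (rule norm_le_l1_cart)
      also have "\<dots> \<le> (\<Sum>i\<in>(UNIV::'n set). h)"
      proof (rule sum_mono)
        show "\<bar>(s - c) $ i\<bar> \<le> h" for i
          using g[OF c(1), of i] by (simp add: c r_def)
      qed
      also have "\<dots> = \<epsilon>"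
        by (simp add: h_def)
      finally show ?thesis
        using c by blast
    qed
    show "\<exists>s\<in>r ` T. s \<le> c" if c: "c \<in> C" for c
    proof -
      obtain t where t: "t \<in> T" "\<forall>i. t i \<le> g c i"
        using T(3) c by blast
      have "r t $ i \<le> c $ i" for i
      proof -
        have "h * real (t i) \<le> h * real (g c i)"
          using t h by (intro mult_left_mono) auto
        then show ?thesis
          using g[OF c, of i] by (simp add: r_def)
      qed
      then show ?thesis
        using t(1) by (auto simp: less_eq_vec_def)
    qed
  qed
qed

section \<open>Approximation and convergence\<close>

lemma set_dist_le: "a \<in> A \<Longrightarrow> set_dist x A \<le> ereal (norm (x - a))"
  unfolding set_dist_def by (rule INF_lower)

lemma set_dist_nonneg: "0 \<le> set_dist x A"
  unfolding set_dist_def by (rule INF_greatest) simp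

lemma set_dist_eq_0: "x \<in> A \<Longrightarrow> set_dist x A = 0"
  using set_dist_le[of x A x] set_dist_nonneg[of x A] by (simp add: zero_ereal_def)

lemma set_dist_attained:
  fixes A :: "'a::euclidean_space set"
  assumes "closed A" "set_dist x A \<le> ereal r"
  obtains a where "a \<in> A" "norm (x - a) \<le> r"
proof -
  have "A \<noteq> {}"
    using assms by (auto simp: set_dist_def top_ereal_def)
  then obtain a where a: "a \<in> A" "\<And>y. y \<in> A \<Longrightarrow> dist x a \<le> dist x y"
    using distance_attains_inf[OF assms(1)] by metis
  then have "ereal (norm (x - a)) \<le> set_dist x A"
    unfolding set_dist_def by (intro INF_greatest) (simp add: dist_norm)
  then have "norm (x - a) \<le> r"
    using assms(2) by (metis ereal_less_eq(3) order_trans)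
  then show ?thesis
    using a that by blast
qed

lemma excess_le_iff: "excess A B \<le> r \<longleftrightarrow> (\<forall>a\<in>A. set_dist a B \<le> r)"
  unfolding excess_def by (rule SUP_le_iff)

lemma excess_0_iff:
  fixes A B :: "'a::euclidean_space set"
  assumes "closed B"
  shows "excess A B \<le> 0 \<longleftrightarrow> A \<subseteq> B"
proof
  assume ex: "excess A B \<le> 0"
  show "A \<subseteq> B"
  proof
    fix x assume "x \<in> A"
    then have "set_dist x B \<le> ereal 0"
      using ex by (simp add: excess_le_iff zero_ereal_def)
    then show "x \<in> B"
      using set_dist_attained[OF assms] by fastforce
  qed
qed (auto simp: excess_le_iff set_dist_eq_0)

text \<open>The distance compares only the parts in the unit ball; these determine the cones by scaling.\<close>

lemma cone_hausdorff_dist_0_imp_eq: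
  fixes K L :: "'a::euclidean_space set"
  assumes "closed K" "closed L" and cone: "conic K" "conic L"
    and 0: "cone_hausdorff_dist K L \<le> 0"
  shows "K = L"
proof -
  have eq: "K \<inter> cball 0 1 = L \<inter> cball 0 1"
    using 0 assms
    by (intro equalityI) (simp_all add: cone_hausdorff_dist_def hausdorff_dist_def excess_0_iff closed_Int)
  have *: "A \<subseteq> B" if "conic A" "conic B" "A \<inter> cball 0 1 \<subseteq> B" for A B :: "'a set"
  proof
    fix x assume x: "x \<in> A"
    \<comment> \<open>This factor moves \<open>x\<close> into the unit ball and makes sense for \<open>x = 0\<close>.\<close>
    let ?c = "1 / (norm x + 1)"
    have pos: "0 < norm x + 1"
      by (simp add: add_nonneg_pos)
    have "?c *\<^sub>R x \<in> A"
      using \<open>conic A\<close> x by (simp add: conic_def)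
    moreover have "norm (?c *\<^sub>R x) \<le> 1"
      using pos by simp
    ultimately have "?c *\<^sub>R x \<in> B"
      using that(3) by auto
    then have "(norm x + 1) *\<^sub>R (?c *\<^sub>R x) \<in> B"
      using \<open>conic B\<close> pos unfolding conic_def by (meson less_imp_le)
    moreover have "(norm x + 1) *\<^sub>R (?c *\<^sub>R x) = x"
      using pos by simp
    ultimately show "x \<in> B"
      by simp
  qed
  show ?thesis
    using *[of K L] *[of L K] cone eq by blast
qed

lemma approximation_0_recession_cone_eq:
  assumes "approximation_of \<epsilon> 0 C P" "closed C"
  shows "recession_cone P = recession_cone C"
  using assms
  by (intro cone_hausdorff_dist_0_imp_eq)
     (auto simp: approximation_of_def closed_recession_cone polyhedron_imp_closed conic_def
       recession_cone_scaleR zero_ereal_def)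

text \<open>Only the vertices of \<open>P\<close> are assumed to be close to \<open>C\<close>. Closeness extends to their convex hull,
  because the neighbourhood \<open>C + cball 0 \<epsilon>\<close> is convex, and then to \<open>P\<close>, because \<open>P\<close> and \<open>C\<close>
  share their recession directions.\<close>

lemma approximation_0_uniformly_close:
  assumes P: "approximation_of \<epsilon> 0 C P" and C: "closed C" "convex C" and x: "x \<in> P"
  shows "\<exists>c\<in>C. norm (x - c) \<le> \<epsilon>"
proof -
  have "polyhedron P" "line_free P" and ex: "excess (vert P) C \<le> ereal \<epsilon>"
    using P by (auto simp: approximation_of_def)
  then have "P = convex hull (vert P) + recession_cone C"
    using line_free_eq_convex_hull_extreme_points_plus_recession_cone[of P]
      approximation_0_recession_cone_eq[OF P C(1)]
    by (simp add: polyhedron_imp_closed polyhedron_imp_convex)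
  then obtain p d where pd: "p \<in> convex hull (vert P)" "d \<in> recession_cone C" "x = p + d"
    using x by (metis set_plus_elim)
  have "vert P \<subseteq> C + cball 0 \<epsilon>"
  proof
    fix v assume "v \<in> vert P"
    then obtain c where "c \<in> C" "norm (v - c) \<le> \<epsilon>"
      using ex set_dist_attained[OF C(1)] unfolding excess_le_iff by metis
    then show "v \<in> C + cball 0 \<epsilon>"
      using set_plus_intro[of c C "v - c" "cball 0 \<epsilon>"] by simp
  qed
  then have "convex hull (vert P) \<subseteq> C + cball 0 \<epsilon>"
    using C by (intro hull_minimal convex_set_plus convex_cball)
  then obtain c b where "c \<in> C" "norm b \<le> \<epsilon>" "p = c + b"
    using pd(1) by (auto elim!: set_plus_elim)
  moreover have "c + d \<in> C"
    using recession_coneD[OF pd(2) \<open>c \<in> C\<close>, of 1] by simp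
  ultimately show ?thesis
    using pd(3) by (intro bexI[of _ "c + d"]) auto
qed

lemma exists_approximation_same_recession_cone:
  fixes C :: "(real ^ 'n) set"
  assumes "C \<noteq> {}" "C \<subseteq> nonneg_orthant" "recession_cone C = nonneg_orthant" "\<epsilon> > 0"
  shows "\<exists>P. polyhedron P \<and> C \<subseteq> P \<and> recession_cone P = recession_cone C \<and>
    approximation_of \<epsilon> 0 C P"
proof -
  let ?K = "nonneg_orthant :: (real ^ 'n) set"
  obtain S where S: "finite S" "S \<subseteq> ?K"
      "\<And>s. s \<in> S \<Longrightarrow> \<exists>c\<in>C. norm (s - c) \<le> \<epsilon>" "\<And>c. c \<in> C \<Longrightarrow> \<exists>s\<in>S. s \<le> c"
    using finite_lower_net[OF assms(2,4)] by blast
  define P where "P = convex hull S + ?K"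
  have K: "convex_cone ?K"
    unfolding nonneg_orthant_eq_convex_cone_hull by (rule convex_cone_convex_cone_hull)
  have poly: "polyhedron P"
    unfolding P_def nonneg_orthant_eq_convex_cone_hull
    using S(1) by (intro polyhedron_convex_hull_plus_convex_cone_hull) auto
  have CP: "C \<subseteq> P"
  proof
    fix c assume "c \<in> C"
    then obtain s where "s \<in> S" "s \<le> c"
      using S(4) by blast
    then have "s \<in> convex hull S" "c - s \<in> ?K"
      by (auto simp: hull_inc nonneg_orthant_iff less_eq_vec_def)
    then show "c \<in> P"
      using set_plus_intro[of s "convex hull S" "c - s" ?K] by (simp add: P_def)
  qed
  have rec: "recession_cone P = ?K"
  proof (rule recession_cone_upper_subset_orthant)
    show "P \<noteq> {}"
      using CP assms by blast
    have "convex hull S \<subseteq> ?K"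
      using S(2) K by (intro hull_minimal) (auto simp: convex_cone_def)
    then show "P \<subseteq> ?K"
      unfolding P_def using convex_cone_add[OF K] by (auto elim!: set_plus_elim)
    show "y \<in> P" if "x \<in> P" "x \<le> y" for x y
    proof -
      obtain p k where pk: "p \<in> convex hull S" "k \<in> ?K" "x = p + k"
        using \<open>x \<in> P\<close> by (auto simp: P_def elim: set_plus_elim)
      have "y - x \<in> ?K"
        using \<open>x \<le> y\<close> by (simp add: nonneg_orthant_iff less_eq_vec_def)
      then have "p + (k + (y - x)) \<in> P"
        unfolding P_def using pk K by (intro set_plus_intro convex_cone_add)
      then show ?thesis
        using pk(3) by (simp add: algebra_simps)
    qed
  qed
  have "vert P \<subseteq> S"
  proof -
    have "vert P \<subseteq> vert (convex hull S)"
      unfolding P_def using K by (intro vert_plus_subset) (auto simp: convex_cone_iff)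
    then show ?thesis
      using extreme_point_of_convex_hull by (fastforce simp: vert_def)
  qed
  then have "excess (vert P) C \<le> ereal \<epsilon>"
    unfolding excess_le_iff using S(3) set_dist_le
    by (meson ereal_less_eq(3) order_trans subsetD)
  moreover have "cone_hausdorff_dist (recession_cone P) (recession_cone C) \<le> ereal 0"
    using rec assms(3)
    by (auto simp: cone_hausdorff_dist_def hausdorff_dist_def excess_le_iff set_dist_eq_0 zero_ereal_def[symmetric])
  ultimately have "approximation_of \<epsilon> 0 C P"
    unfolding approximation_of_def
    using poly CP line_free_if_recession_cone_orthant[OF rec] by blast
  then show ?thesis
    using poly CP rec assms(3) by auto
qed

text \<open>Points of \<open>C\<close> have distance \<open>0\<close> to every \<open>P \<nu>\<close>. Conversely, a point with lower limit distance
  \<open>0\<close> is close to \<open>P \<nu>\<close> for infinitely many \<open>\<nu>\<close>, hence arbitrarily close to \<open>C\<close>.\<close>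

lemma pk_converges_if_uniformly_close:
  fixes C :: "'a::euclidean_space set"
  assumes "closed C" and sub: "\<And>\<nu>. C \<subseteq> P \<nu>"
    and close: "\<And>\<nu> x. x \<in> P \<nu> \<Longrightarrow> \<exists>c\<in>C. norm (x - c) \<le> \<epsilon> \<nu>" and \<epsilon>: "\<epsilon> \<longlonglongrightarrow> 0"
  shows "pk_converges P C"
proof -
  have 1: "(\<lambda>\<nu>. set_dist x (P \<nu>)) \<longlonglongrightarrow> 0" if "x \<in> C" for x
  proof -
    have "set_dist x (P \<nu>) = 0" for \<nu>
      using that sub by (intro set_dist_eq_0) auto
    then show ?thesis
      by simp
  qed
  have 2: "liminf (\<lambda>\<nu>. set_dist x (P \<nu>)) = 0" if "(\<lambda>\<nu>. set_dist x (P \<nu>)) \<longlonglongrightarrow> 0" for x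
    using that by (intro lim_imp_Liminf) auto
  have 3: "x \<in> C" if x: "liminf (\<lambda>\<nu>. set_dist x (P \<nu>)) = 0" for x
  proof -
    have "\<exists>c\<in>C. dist c x < e" if "e > 0" for e
    proof -
      have "liminf (\<lambda>\<nu>. set_dist x (P \<nu>)) < ereal (e / 2)"
        using x \<open>e > 0\<close> by (simp add: zero_ereal_def)
      then have "\<not> (\<forall>\<^sub>F \<nu> in sequentially. ereal (e / 2) \<le> set_dist x (P \<nu>))"
        by (auto dest!: Liminf_bounded simp: not_le[symmetric])
      then have "\<exists>\<^sub>F \<nu> in sequentially. set_dist x (P \<nu>) < ereal (e / 2)"
        by (simp add: frequently_def not_less)
      moreover have "\<forall>\<^sub>F \<nu> in sequentially. \<epsilon> \<nu> < e / 2"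
        using \<epsilon> \<open>e > 0\<close> by (intro order_tendstoD) auto
      ultimately obtain \<nu> where \<nu>: "set_dist x (P \<nu>) < ereal (e / 2)" "\<epsilon> \<nu> < e / 2"
        using frequently_ex[OF frequently_eventually_frequently] by blast
      then obtain p where p: "p \<in> P \<nu>" "norm (x - p) < e / 2"
        unfolding set_dist_def INF_less_iff by auto
      obtain c where c: "c \<in> C" "norm (p - c) \<le> \<epsilon> \<nu>"
        using close[OF p(1)] by blast
      have "norm (x - c) \<le> norm (x - p) + norm (p - c)"
        using norm_triangle_ineq[of "x - p" "p - c"] by simp
      then have "dist c x < e"
        using p(2) c(2) \<nu>(2) by (simp add: dist_norm norm_minus_commute)
      then show ?thesis
        using c(1) by blast
    qed
    then have "x \<in> closure C"
      by (simp add: closure_approachable)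
    then show ?thesis
      using \<open>closed C\<close> by simp
  qed
  show ?thesis
    unfolding pk_converges_def using 1 2 3 by blast
qed

theorem theorem10:
  fixes F :: "'f::order set"
    and dp :: "('f \<times> (real ^ 'n)) set"
    and xF :: 'f
    and C :: "(real ^ 'n) set"
  assumes dp: "design_problem F nonneg_orthant dp"
    and xF: "xF \<in> F"
    and C: "C = feasible_resources nonneg_orthant dp xF"
    and nonempty: "C \<noteq> {}"
    and closed: "closed C"
    and convex: "convex C"
  shows "(recession_cone C = nonneg_orthant \<and> line_free C \<and> self_bounded C) \<and>
    (\<forall>\<epsilon>>0. \<exists>P. polyhedron P \<and> C \<subseteq> P \<and> recession_cone P = recession_cone C \<and>
       approximation_of \<epsilon> 0 C P) \<and>
    (\<forall>P \<epsilon>. (\<forall>\<nu>. approximation_of (\<epsilon> \<nu>) 0 C (P \<nu>)) \<and> \<epsilon> \<longlonglongrightarrow> 0 \<longrightarrow>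
       pk_converges P C)"
proof -
  have sub: "C \<subseteq> nonneg_orthant"
    by (auto simp: C feasible_resources_def)
  have up: "y \<in> C" if "x \<in> C" "x \<le> y" for x y
  proof -
    have "x \<in> nonneg_orthant" "(xF, x) \<in> dp"
      using \<open>x \<in> C\<close> by (auto simp: C feasible_resources_def)
    moreover from this have "y \<in> nonneg_orthant"
      using \<open>x \<le> y\<close> by (auto simp: nonneg_orthant_def)
    ultimately show ?thesis
      using dp xF \<open>x \<le> y\<close> unfolding C feasible_resources_def design_problem_def by blast
  qed
  have rec: "recession_cone C = nonneg_orthant"
    by (rule recession_cone_upper_subset_orthant[OF nonempty sub up])
  have "1 \<in> (nonneg_orthant :: (real ^ 'n) set)"
    by (simp add: nonneg_orthant_iff)
  then have "recession_cone C \<noteq> {0}"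
    unfolding rec by (metis singletonD zero_neq_one)
  moreover have "C \<subseteq> (\<lambda>d. 0 + d) ` recession_cone C"
    using sub rec by simp
  ultimately have "self_bounded C"
    unfolding self_bounded_def by blast
  moreover have "pk_converges P C"
    if approx: "\<forall>\<nu>. approximation_of (\<epsilon> \<nu>) 0 C (P \<nu>)" and "\<epsilon> \<longlonglongrightarrow> 0" for P \<epsilon>
  proof (rule pk_converges_if_uniformly_close[OF closed _ _ \<open>\<epsilon> \<longlonglongrightarrow> 0\<close>])
    show "C \<subseteq> P \<nu>" for \<nu>
      using approx by (simp add: approximation_of_def)
    show "\<exists>c\<in>C. norm (x - c) \<le> \<epsilon> \<nu>" if "x \<in> P \<nu>" for x \<nu>
      using approximation_0_uniformly_close[OF _ closed convex that] approx by blast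
  qed
  ultimately show ?thesis
    using rec line_free_if_recession_cone_orthant[OF rec]
      exists_approximation_same_recession_cone[OF nonempty sub rec] by blast
qed

end
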